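(* Let $G$ be a finite group. Then $$\frac{b(G)^2}{k(G)^{1/2}\,|G|^{1/2}} \;\le\; K(G) \;\le\; b(G).$$
   Context: For a finite group $G$, $\mathrm{Irr}(G)$ is the set of irreducible complex characters of $G$; $k(G)=|\mathrm{Irr}(G)|$ is the number of conjugacy classes of $G$; $b(G)=\max_{\rho\in \mathrm{Irr}(G)}\rho(1)$ is the largest degree of an irreducible character. The Kronecker multiplicities $g(\rho,\varphi,\psi)$, for $\rho,\varphi,\psi\in\mathrm{Irr}(G)$, are the nonnegative integers defined by $\varphi\cdot\psi=\sum_{\rho\in\mathrm{Irr}(G)} g(\rho,\varphi,\psi)\,\rho$, where $\varphi\cdot\psi$ is the pointwise product of characters. The largest Kronecker multiplicity is $K(G)=\max_{\rho,\varphi,\psi\in\mathrm{Irr}(G)} g(\rho,\varphi,\psi)$. *)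

theory Defs
  imports Complex_Main "HOL-Algebra.Coset" "Jordan_Normal_Form.VS_Connect"
begin

abbreviation general_linear :: "nat \<Rightarrow> complex mat monoid" where
  "general_linear n \<equiv> units_of (ring_mat TYPE(complex) n ())"

text \<open>Complex representations are taken in matrix form, on the space of column vectors of
  length \<open>n\<close>; every finite-dimensional complex representation is isomorphic to one of these.\<close>

definition representation :: "('g, 'r) monoid_scheme \<Rightarrow> nat \<Rightarrow> ('g \<Rightarrow> complex mat) \<Rightarrow> bool" where
  "representation G n R \<longleftrightarrow> R \<in> hom G (general_linear n)"

definition invariant_subspace ::
    "('g, 'r) monoid_scheme \<Rightarrow> nat \<Rightarrow> ('g \<Rightarrow> complex mat) \<Rightarrow> complex vec set \<Rightarrow> bool" where
  "invariant_subspace G n R W \<longleftrightarrow>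
     VectorSpace.subspace class_ring W (module_vec TYPE(complex) n) \<and>
     (\<forall>g\<in>carrier G. \<forall>w\<in>W. R g *\<^sub>v w \<in> W)"

definition irreducible_representation ::
    "('g, 'r) monoid_scheme \<Rightarrow> nat \<Rightarrow> ('g \<Rightarrow> complex mat) \<Rightarrow> bool" where
  "irreducible_representation G n R \<longleftrightarrow>
     representation G n R \<and> n > 0 \<and>
     (\<forall>W. invariant_subspace G n R W \<longrightarrow> W = {0\<^sub>v n} \<or> W = carrier_vec n)"

definition trace_mat :: "complex mat \<Rightarrow> complex" where
  "trace_mat A = (\<Sum>i<dim_row A. A $$ (i, i))"

text \<open>Characters are extensional functions (\<open>undefined\<close> off the carrier), so that two characters
  are equal in HOL exactly when they agree on the group.\<close>

definition character :: "('g, 'r) monoid_scheme \<Rightarrow> ('g \<Rightarrow> complex mat) \<Rightarrow> 'g \<Rightarrow> complex" where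
  "character G R = (\<lambda>g\<in>carrier G. trace_mat (R g))"

definition Irr :: "('g, 'r) monoid_scheme \<Rightarrow> ('g \<Rightarrow> complex) set" where
  "Irr G = {character G R | n R. irreducible_representation G n R}"

definition num_irr :: "('g, 'r) monoid_scheme \<Rightarrow> nat" where
  "num_irr G = card (Irr G)"

text \<open>The value of a character at the identity is the trace of an identity matrix, a natural number;
  \<open>Re\<close> only moves it to an ordered type.\<close>

definition max_degree :: "('g, 'r) monoid_scheme \<Rightarrow> real" where
  "max_degree G = Max {Re (\<rho> \<one>\<^bsub>G\<^esub>) | \<rho>. \<rho> \<in> Irr G}"

text \<open>\<open>kronecker_mult G \<rho> \<phi> \<psi>\<close> is the coefficient of \<open>\<rho>\<close> in the decomposition of
  \<open>\<phi> \<cdot> \<psi>\<close> into irreducible characters. The support condition makes the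
  coefficient function \<open>m\<close> unique.\<close>

definition kronecker_mult ::
    "('g, 'r) monoid_scheme \<Rightarrow> ('g \<Rightarrow> complex) \<Rightarrow> ('g \<Rightarrow> complex) \<Rightarrow> ('g \<Rightarrow> complex) \<Rightarrow> nat" where
  "kronecker_mult G \<rho> \<phi> \<psi> =
     (THE m :: ('g \<Rightarrow> complex) \<Rightarrow> nat.
        (\<forall>\<chi>. \<chi> \<notin> Irr G \<longrightarrow> m \<chi> = 0) \<and>
        (\<forall>x\<in>carrier G. \<phi> x * \<psi> x = (\<Sum>\<chi>\<in>Irr G. of_nat (m \<chi>) * \<chi> x))) \<rho>"

definition max_kronecker_mult :: "('g, 'r) monoid_scheme \<Rightarrow> nat" where
  "max_kronecker_mult G =
     Max {kronecker_mult G \<rho> \<phi> \<psi> | \<rho> \<phi> \<psi>. \<rho> \<in> Irr G \<and> \<phi> \<in> Irr G \<and> \<psi> \<in> Irr G}"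

end

theory Submission
  imports Defs "HOL-Algebra.Multiplicative_Group"
    "Jordan_Normal_Form.Spectral_Radius" "Jordan_Normal_Form.DL_Rank"
begin

text \<open>Write \<open>\<langle>\<phi>, \<psi>\<rangle> = \<Sum>\<^sub>x \<phi>(x) cnj(\<psi>(x))\<close>, so that irreducible characters have squared length \<open>|G|\<close>.
  Upper bound: \<open>|G| g(\<rho>, \<phi>, \<psi>) = \<langle>\<phi>\<psi>, \<rho>\<rangle>\<close>, where \<open>|\<phi>(x)| \<le> \<phi>(1)\<close>, and the remaining sum of
  \<open>|\<psi>(x)| |\<rho>(x)|\<close> is at most \<open>|G|\<close> by AM-GM. Lower bound: for \<open>\<phi>\<close> of degree \<open>b(G)\<close>, the term \<open>x = 1\<close>
  gives \<open>b(G)^4 \<le> \<Sum>\<^sub>x |\<phi>(x)|^4 = \<langle>\<phi>^2, \<phi>^2\<rangle> = |G| \<Sum>\<^sub>\<rho> g(\<rho>, \<phi>, \<phi>)^2 \<le> |G| k(G) K(G)^2\<close>.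

  The character theory needs neither unitary representations nor Maschke's theorem:
  triangularizing a matrix of finite order gives \<open>\<chi>(inv x) = cnj (\<chi>(x))\<close> and \<open>|\<chi>(x)| \<le> \<chi>(1)\<close>, and
  decomposing a character into irreducible ones only takes a block triangular form.\<close>

subsection \<open>Matrices\<close>

lemma index_mult_mat_sum:
  assumes "A \<in> carrier_mat n m" "B \<in> carrier_mat m p" "i < n" "j < p"
  shows "(A * B) $$ (i, j) = (\<Sum>k<m. A $$ (i, k) * B $$ (k, j))"
  using assms by (auto simp: scalar_prod_def lessThan_atLeast0 intro!: sum.cong)

lemma trace_mat_carrier: "A \<in> carrier_mat n m \<Longrightarrow> trace_mat A = (\<Sum>i<n. A $$ (i, i))"
  by (auto simp: trace_mat_def)

lemma trace_mat_comm:
  assumes "A \<in> carrier_mat n m" "B \<in> carrier_mat m n"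
  shows "trace_mat (A * B) = trace_mat (B * A)"
proof -
  have "trace_mat (A * B) = (\<Sum>i<n. \<Sum>k<m. A $$ (i, k) * B $$ (k, i))"
    using assms
    by (simp add: trace_mat_carrier[of _ n n] index_mult_mat_sum[OF assms] del: index_mult_mat(1))
  also have "\<dots> = (\<Sum>k<m. \<Sum>i<n. B $$ (k, i) * A $$ (i, k))"
    by (subst sum.swap) (simp add: mult.commute)
  also have "\<dots> = trace_mat (B * A)"
    using assms
    by (simp add: trace_mat_carrier[of _ m m] index_mult_mat_sum[OF assms(2,1)] del: index_mult_mat(1))
  finally show ?thesis .
qed

text \<open>Cyclicity of the trace brings \<open>P\<close> to the front, where \<open>P * Q\<close>
  cancels. The sizes \<open>n\<close> and \<open>m\<close> stay separate because
  \<open>schur_characters_eq\<close> applies this to an intertwiner between spaces whose dimensions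
  have not been compared.\<close>

lemma trace_mat_conj:
  assumes "A \<in> carrier_mat n n" "P \<in> carrier_mat n m" "Q \<in> carrier_mat m n" "P * Q = 1\<^sub>m n"
  shows "trace_mat (Q * A * P) = trace_mat A"
proof -
  have "trace_mat (Q * A * P) = trace_mat (P * (Q * A))"
    using assms by (intro trace_mat_comm[of _ m n]) auto
  also have "P * (Q * A) = A"
    using assms by (subst assoc_mult_mat[symmetric, of _ n m _ n _ n]) auto
  finally show ?thesis .
qed

section \<open>Triangular matrices and matrices of finite order\<close>

lemma upper_triangular_mult:
  fixes A B :: "'a :: comm_semiring_1 mat"
  assumes "A \<in> carrier_mat n n" "B \<in> carrier_mat n n" "upper_triangular A" "upper_triangular B"
  shows "upper_triangular (A * B)"
    and "i < n \<Longrightarrow> (A * B) $$ (i, i) = A $$ (i, i) * B $$ (i, i)"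
proof -
  \<comment> \<open>On or below the diagonal only the summand with i = j = k can survive: for k < i
    the factor from \<open>A\<close> lies below its diagonal, otherwise j < k and the factor from
    \<open>B\<close> does.\<close>
  have z: "A $$ (i, k) * B $$ (k, j) = 0" if "i < n" "k < n" "j \<le> i" "k \<noteq> i \<or> j < i" for i j k
  proof (cases "k < i")
    case True
    then show ?thesis using that assms by (auto simp: upper_triangularD[OF assms(3)])
  next
    case False
    then show ?thesis using that assms by (auto simp: upper_triangularD[OF assms(4)])
  qed
  show "upper_triangular (A * B)"
    by (rule upper_triangularI, subst index_mult_mat_sum[OF assms(1,2)])
      (use assms z in \<open>auto intro!: sum.neutral\<close>)
  show "(A * B) $$ (i, i) = A $$ (i, i) * B $$ (i, i)" if "i < n"
  proof -
    have "(A * B) $$ (i, i) = (\<Sum>k<n. if k = i then A $$ (i, i) * B $$ (i, i) else 0)"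
      by (subst index_mult_mat_sum[OF assms(1,2) that that], rule sum.cong) (use z[of i] that in \<open>auto split: if_splits\<close>)
    then show ?thesis using that by simp
  qed
qed

lemma upper_triangular_pow:
  fixes A :: "'a :: comm_semiring_1 mat"
  assumes "A \<in> carrier_mat n n" "upper_triangular A"
  shows "upper_triangular (A ^\<^sub>m k)" "i < n \<Longrightarrow> (A ^\<^sub>m k) $$ (i, i) = A $$ (i, i) ^ k"
proof (induction k)
  case (Suc k)
  have "A ^\<^sub>m k \<in> carrier_mat n n" using assms by simp
  from upper_triangular_mult[OF this assms(1)] Suc assms(2)
  show "upper_triangular (A ^\<^sub>m Suc k)"
    "i < n \<Longrightarrow> (A ^\<^sub>m Suc k) $$ (i, i) = A $$ (i, i) ^ Suc k"
    by (auto simp: ac_simps)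
qed (use assms in auto)

text \<open>\<open>ds\<close> is the diagonal of a triangular form \<open>B\<close> of
  \<open>A\<close>. Powers of \<open>B\<close> stay triangular and carry the powers of these
  entries, so one list serves every exponent \<open>k\<close>; this later ties the trace of a group
  element to that of its inverse.\<close>

lemma trace_pow_finite_order:
  fixes A :: "complex mat"
  assumes A: "A \<in> carrier_mat n n" and 1: "A ^\<^sub>m m = 1\<^sub>m n"
  obtains ds where "length ds = n" "\<And>d. d \<in> set ds \<Longrightarrow> d ^ m = 1"
    "\<And>k. trace_mat (A ^\<^sub>m k) = (\<Sum>d\<leftarrow>ds. d ^ k)"
proof -
  obtain es where "char_poly A = (\<Prod>a\<leftarrow>es. [:- a, 1:])"
    using char_poly_factorized[OF A] by blast
  from schur_decomposition_exists[OF A this]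
  obtain B where B: "B \<in> carrier_mat n n" "upper_triangular B" "similar_mat A B" by blast
  then obtain P Q where wit: "similar_mat_wit A B P Q" by (auto simp: similar_mat_def)
  from similar_mat_witD2[OF A wit] have PQ: "P \<in> carrier_mat n n" "Q \<in> carrier_mat n n"
    "P * Q = 1\<^sub>m n" "Q * P = 1\<^sub>m n" by auto
  have pow: "A ^\<^sub>m k = P * B ^\<^sub>m k * Q" for k by (rule similar_mat_wit_pow_id[OF wit])
  \<comment> \<open>Inserting \<open>Q * P\<close> on both sides exhibits
    \<open>B ^\<^sub>m m\<close> as a conjugate of \<open>A ^\<^sub>m m\<close>, so \<open>B\<close>
    inherits the finite order.\<close>
  have "B ^\<^sub>m m = (Q * P) * B ^\<^sub>m m * (Q * P)" using B PQ by simp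
  also have "\<dots> = Q * (P * B ^\<^sub>m m * Q) * P"
    using B(1) PQ(1,2) by (simp add: assoc_mult_mat[of _ n n _ n _ n] mult_carrier_mat[of _ n n])
  also have "\<dots> = 1\<^sub>m n" using PQ by (simp flip: pow add: 1)
  finally have Bm: "B ^\<^sub>m m = 1\<^sub>m n" .
  show ?thesis
  proof
    show "length (map (\<lambda>i. B $$ (i, i)) [0..<n]) = n" by simp
    show "d ^ m = 1" if "d \<in> set (map (\<lambda>i. B $$ (i, i)) [0..<n])" for d
      using that upper_triangular_pow(2)[OF B(1,2), of _ m] by (auto simp: Bm)
    show "trace_mat (A ^\<^sub>m k) = (\<Sum>d\<leftarrow>map (\<lambda>i. B $$ (i, i)) [0..<n]. d ^ k)" for k
    proof -
      have "trace_mat (A ^\<^sub>m k) = trace_mat (B ^\<^sub>m k)"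
        unfolding pow using B PQ by (intro trace_mat_conj[of _ n]) auto
      also have "\<dots> = (\<Sum>i<n. B $$ (i, i) ^ k)"
        using B by (simp add: trace_mat_carrier[of _ n n] upper_triangular_pow)
      finally show ?thesis
        by (simp add: comp_def interv_sum_list_conv_sum_set_nat lessThan_atLeast0)
    qed
  qed
qed

section \<open>Subspaces, invertibility and adapted bases\<close>

lemma subspace_vec_iff:
  "VectorSpace.subspace class_ring W (module_vec TYPE('a :: field) n) \<longleftrightarrow>
     W \<subseteq> carrier_vec n \<and> 0\<^sub>v n \<in> W \<and> (\<forall>v\<in>W. \<forall>w\<in>W. v + w \<in> W) \<and> (\<forall>c. \<forall>v\<in>W. c \<cdot>\<^sub>v v \<in> W)"
  by (auto simp: VectorSpace.subspace_def submodule_def vec_vs vec_module module_vec_simps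
      class_ring_simps)

lemma mult_mat_vec_unit:
  fixes A :: "'a :: semiring_1 mat"
  assumes "A \<in> carrier_mat n m" "j < m"
  shows "A *\<^sub>v unit_vec m j = col A j"
  using assms by (intro eq_vecI) auto

lemma mat_eq_by_vec:
  fixes A B :: "'a :: semiring_1 mat"
  assumes "A \<in> carrier_mat n m" "B \<in> carrier_mat n m"
    and "\<And>v. v \<in> carrier_vec m \<Longrightarrow> A *\<^sub>v v = B *\<^sub>v v"
  shows "A = B"
proof (rule mat_col_eqI)
  fix j assume "j < dim_col B"
  then show "col A j = col B j"
    using assms(3)[of "unit_vec m j"] assms(1,2)
      mult_mat_vec_unit[OF assms(1), of j] mult_mat_vec_unit[OF assms(2), of j] by simp
qed (use assms in auto)

text \<open>Preimages of the unit vectors, taken as columns of \<open>B\<close>, give a right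
  inverse. Injectivity makes it a left inverse too, because \<open>A\<close> sends
  \<open>B * A *\<^sub>v v - v\<close> to zero.\<close>

lemma bijective_mat_invertible:
  fixes A :: "'a :: comm_ring_1 mat"
  assumes A: "A \<in> carrier_mat m n"
    and inj: "\<And>v. v \<in> carrier_vec n \<Longrightarrow> A *\<^sub>v v = 0\<^sub>v m \<Longrightarrow> v = 0\<^sub>v n"
    and surj: "\<And>w. w \<in> carrier_vec m \<Longrightarrow> \<exists>v\<in>carrier_vec n. A *\<^sub>v v = w"
  obtains B where "B \<in> carrier_mat n m" "A * B = 1\<^sub>m m" "B * A = 1\<^sub>m n"
proof -
  have "\<forall>j. \<exists>v\<in>carrier_vec n. A *\<^sub>v v = unit_vec m j" using surj by simp
  then obtain f where f: "\<And>j. f j \<in> carrier_vec n" "\<And>j. A *\<^sub>v f j = unit_vec m j" by metis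
  define B where "B = mat_of_cols n (map f [0..<m])"
  have B: "B \<in> carrier_mat n m" by (auto simp: B_def)
  have AB: "A * B = 1\<^sub>m m"
  proof (rule mat_col_eqI)
    fix j assume "j < dim_col (1\<^sub>m m :: 'a mat)"
    then have j: "j < m" by simp
    then have "col B j = f j" unfolding B_def using f(1) by (subst col_mat_of_cols) auto
    then show "col (A * B) j = col (1\<^sub>m m) j" using col_mult2[OF A B j] f(2) j by simp
  qed (use A B in auto)
  have "B * A = 1\<^sub>m n"
  proof (rule mat_eq_by_vec)
    fix v :: "'a vec" assume v: "v \<in> carrier_vec n"
    have "A *\<^sub>v (B * A *\<^sub>v v) = (A * B) * A *\<^sub>v v"
      using A B v by (simp add: assoc_mult_mat_vec[of _ m n _ n] assoc_mult_mat[of _ m n _ m _ n])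
    then have "A *\<^sub>v (B * A *\<^sub>v v) = A *\<^sub>v v" using A AB by simp
    then have "A *\<^sub>v (B * A *\<^sub>v v - v) = 0\<^sub>v m"
      using A B v by (subst mult_minus_distrib_mat_vec[of _ m n]) auto
    then have "B * A *\<^sub>v v - v = 0\<^sub>v n" using A B v by (intro inj) auto
    then have "B * A *\<^sub>v v = v" using A B v
      by (intro eq_vecI) (auto dest!: arg_cong[where f = "\<lambda>u. u $ _"] simp: vec_eq_iff)
    then show "B * A *\<^sub>v v = 1\<^sub>m n *\<^sub>v v" using v by simp
  qed (use A B in auto)
  with AB B that show ?thesis by blast
qed

text \<open>The columns of \<open>P\<close> are a basis of \<open>W\<close> extended to the whole
  space, and \<open>Q\<close> reads off coordinates. Conjugation by \<open>P\<close> thus makes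
  every matrix preserving \<open>W\<close> block upper triangular; both diagonal blocks have
  positive size as \<open>W\<close> is nonzero and proper.\<close>

lemma adapted_basis:
  fixes W :: "'a :: field vec set"
  assumes sub: "VectorSpace.subspace class_ring W (module_vec TYPE('a) n)"
    and nz: "W \<noteq> {0\<^sub>v n}" and proper: "W \<noteq> carrier_vec n"
  obtains P Q d where "P \<in> carrier_mat n n" "Q \<in> carrier_mat n n" "P * Q = 1\<^sub>m n" "Q * P = 1\<^sub>m n"
    "0 < d" "d < n" "\<And>j. j < d \<Longrightarrow> col P j \<in> W"
    "\<And>w i. w \<in> W \<Longrightarrow> d \<le> i \<Longrightarrow> i < n \<Longrightarrow> (Q *\<^sub>v w) $ i = 0"
proof -
  interpret vec_space "TYPE('a)" n .
  have W: "W \<subseteq> carrier_vec n" "0\<^sub>v n \<in> W" using sub by (auto simp: subspace_vec_iff)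
  have bound: "finite S \<and> card S \<le> n" if "S \<subseteq> carrier_vec n" "lin_indpt S" for S
    using li_le_dim[OF fin_dim, of S] that by (simp add: dim_is_n)
  \<comment> \<open>A basis of \<open>W\<close> is obtained as a maximal independent subset, which
    exists since \<open>n\<close> bounds the sizes.\<close>
  have "\<exists>A. finite A \<and> maximal A (\<lambda>S. S \<subseteq> W \<and> lin_indpt S)"
  proof (rule maximal_exists)
    show "finite S \<and> card S \<le> n" if "S \<subseteq> W \<and> lin_indpt S" for S using bound that W by blast
    show "{} \<subseteq> W \<and> lin_indpt {}" by (auto simp: lin_dep_def)
  qed
  then obtain A where A': "finite A" "maximal A (\<lambda>S. S \<subseteq> W \<and> lin_indpt S)" by blast
  then have A: "finite A" "A \<subseteq> W" "lin_indpt A" by (simp_all add: maximal_def)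
  have Amax: "S = A" if "A \<subseteq> S" "S \<subseteq> W" "lin_indpt S" for S
    using A'(2) that unfolding maximal_def by blast
  have "W \<subseteq> span A"
  proof
    fix w assume w: "w \<in> W"
    show "w \<in> span A"
    proof (cases "w \<in> A")
      case True
      then show ?thesis using in_own_span[of A] A W by auto
    next
      case False
      then have "lin_dep (A \<union> {w})" using Amax[of "A \<union> {w}"] A w by auto
      then show ?thesis using lin_dep_iff_in_span[of A w] A W w False by auto
    qed
  qed
  moreover have "span A \<subseteq> W"
    using span_is_subset[of A W] A sub by (auto simp: VectorSpace.subspace_def)
  ultimately have spanA: "span A = W" by blast
  have "\<exists>B. finite B \<and> maximal B (\<lambda>S. A \<subseteq> S \<and> S \<subseteq> carrier_vec n \<and> lin_indpt S)"
  proof (rule maximal_exists)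
    show "finite S \<and> card S \<le> n" if "A \<subseteq> S \<and> S \<subseteq> carrier_vec n \<and> lin_indpt S" for S
      using bound that by blast
    show "A \<subseteq> A \<and> A \<subseteq> carrier_vec n \<and> lin_indpt A" using A W by blast
  qed
  then obtain B where B': "finite B"
      "maximal B (\<lambda>S. A \<subseteq> S \<and> S \<subseteq> carrier_vec n \<and> lin_indpt S)" by blast
  then have B: "finite B" "A \<subseteq> B" "B \<subseteq> carrier_vec n" "lin_indpt B" by (simp_all add: maximal_def)
  \<comment> \<open>Sets containing \<open>B\<close> contain \<open>A\<close>, so \<open>B\<close>
    is maximal among all independent sets and hence a basis.\<close>
  have "maximal B (\<lambda>S. S \<subseteq> carrier_vec n \<and> lin_indpt S)"
    using B'(2) B(2) unfolding maximal_def by (meson order_trans)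
  then have "basis B" by (intro max_li_is_basis) simp
  then have cardB: "card B = n" using dim_basis[OF B(1)] by (simp add: dim_is_n)
  obtain xs where xs: "set xs = A" "distinct xs" using finite_distinct_list[OF A(1)] by blast
  obtain ys where ys: "set ys = B - A" "distinct ys"
    using finite_distinct_list[of "B - A"] B(1) by blast
  define d where "d = length xs"
  have len: "length (xs @ ys) = n"
    using xs ys B cardB distinct_card[of "xs @ ys"] by (simp add: Un_absorb1)
  define P where "P = mat_of_cols n (xs @ ys)"
  have P: "P \<in> carrier_mat n n" using len by (auto simp: P_def)
  have colsP: "cols P = xs @ ys"
    unfolding P_def using xs ys B by (intro cols_mat_of_cols) auto
  have "rank P = n"
    using P B xs ys by (intro lin_indpt_full_rank) (auto simp: colsP Un_absorb1)
  then have "det P \<noteq> 0" using det_rank_iff[OF P] by simp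
  from det_non_zero_imp_unit[OF P this, of "()"] obtain Q
    where Q: "Q \<in> carrier_mat n n" "Q * P = 1\<^sub>m n" "P * Q = 1\<^sub>m n"
    by (auto simp: Units_def ring_mat_simps)
  have colP: "col P j = xs ! j" if "j < d" for j
    using that len P cols_nth[of j P] by (simp add: colsP d_def nth_append)
  \<comment> \<open>The vectors with vanishing last coordinates form a subspace containing the
    spanning set \<open>A\<close>, hence all of \<open>W\<close>.\<close>
  let ?Z = "{w \<in> carrier_vec n. \<forall>i. d \<le> i \<longrightarrow> i < n \<longrightarrow> (Q *\<^sub>v w) $ i = 0}"
  have "A \<subseteq> ?Z"
  proof
    fix w assume w: "w \<in> A"
    then obtain j where j: "j < d" "w = col P j"
      using xs colP by (auto simp: in_set_conv_nth d_def)
    have "Q *\<^sub>v w = col (Q * P) j"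
      using j len col_mult2[OF Q(1) P, of j] by (simp add: d_def)
    also have "\<dots> = unit_vec n j" using Q j len by (simp add: d_def)
    finally show "w \<in> ?Z" using w A W j by auto
  qed
  moreover have "Q *\<^sub>v 0\<^sub>v n = 0\<^sub>v n" using Q by (intro eq_vecI) auto
  then have "VectorSpace.subspace class_ring ?Z V"
    unfolding subspace_vec_iff
    using Q by (auto simp: mult_add_distrib_mat_vec[of _ n n] mult_mat_vec[of _ n n]
        simp del: index_mult_mat_vec)
  ultimately have "span A \<subseteq> ?Z"
    using span_is_subset[of A ?Z] by (auto simp: VectorSpace.subspace_def)
  then have zero: "(Q *\<^sub>v w) $ i = 0" if "w \<in> W" "d \<le> i" "i < n" for w i
    using that spanA by auto
  have "d > 0"
  proof (rule ccontr)
    assume "\<not> d > 0"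
    then have "A = {}" using xs by (simp add: d_def)
    then have "W = {0\<^sub>v n}" using spanA by (simp add: span_empty module_vec_simps)
    with nz show False by simp
  qed
  moreover have "d < n"
  proof (rule ccontr)
    assume "\<not> d < n"
    then have "A = B" using A B xs cardB card_subset_eq[of B A] len distinct_card[of xs]
      by (auto simp: d_def)
    then have "W = carrier_vec n" using \<open>basis B\<close> spanA by (auto simp: basis_def)
    with proper show False by simp
  qed
  moreover have "col P j \<in> W" if "j < d" for j
    using colP[OF that] that xs A by (auto simp: d_def)
  ultimately show ?thesis using that P Q zero by blast
qed

section \<open>Block sums and Kronecker products\<close>

lemma sum_lessThan_split:
  fixes f :: "nat \<Rightarrow> 'a :: comm_monoid_add"
  shows "(\<Sum>k<d + e. f k) = (\<Sum>k<d. f k) + (\<Sum>k<e. f (k + d))"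
  by (induction e) (auto simp: ac_simps)

text \<open>Quotient and remainder by \<open>m\<close> identify the indices below
  \<open>n * m\<close> with pairs; the induction appends one row of \<open>m\<close> indices at a
  time.\<close>

lemma sum_div_mod:
  fixes f :: "nat \<Rightarrow> nat \<Rightarrow> 'a :: comm_monoid_add"
  shows "(\<Sum>k<n * m. f (k div m) (k mod m)) = (\<Sum>i<n. \<Sum>j<m. f i j)"
proof (induction n)
  case (Suc n)
  have "(\<Sum>k<Suc n * m. f (k div m) (k mod m)) = (\<Sum>k<n * m + m. f (k div m) (k mod m))"
    by (simp add: add.commute)
  also have "\<dots> = (\<Sum>i<n. \<Sum>j<m. f i j) + (\<Sum>j<m. f n j)"
    unfolding sum_lessThan_split Suc.IH by (auto intro!: sum.cong)
  finally show ?case by simp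
qed simp

text \<open>The matrix of a tensor product of linear maps in the lexicographically ordered basis of
  pure tensors, a pair of indices being coded by quotient and remainder.\<close>

definition kronecker_product :: "'a :: comm_semiring_1 mat \<Rightarrow> 'a mat \<Rightarrow> 'a mat" where
  "kronecker_product A B = mat (dim_row A * dim_row B) (dim_col A * dim_col B)
     (\<lambda>(a, b). A $$ (a div dim_row B, b div dim_col B) * B $$ (a mod dim_row B, b mod dim_col B))"

lemma kronecker_product_carrier:
  "A \<in> carrier_mat n n' \<Longrightarrow> B \<in> carrier_mat m m' \<Longrightarrow>
     kronecker_product A B \<in> carrier_mat (n * m) (n' * m')"
  by (auto simp: kronecker_product_def)

lemma kronecker_product_index:
  assumes "A \<in> carrier_mat n n'" "B \<in> carrier_mat m m'" "a < n * m" "b < n' * m'"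
  shows "kronecker_product A B $$ (a, b) = A $$ (a div m, b div m') * B $$ (a mod m, b mod m')"
  using assms by (auto simp: kronecker_product_def)

lemma div_mod_less:
  fixes a :: nat
  assumes "a < n * m"
  shows "a div m < n" "a mod m < m"
  using assms by (auto simp: less_mult_imp_div_less intro!: mod_less_divisor gr0I)

text \<open>The double sum for an entry of the right side factors into an entry of
  \<open>A * C\<close> times one of \<open>B * D\<close>. This is what makes the tensor product of
  two representations multiplicative.\<close>

lemma kronecker_product_mult:
  assumes A: "A \<in> carrier_mat n n" "C \<in> carrier_mat n n"
    and B: "B \<in> carrier_mat m m" "D \<in> carrier_mat m m"
  shows "kronecker_product (A * C) (B * D) = kronecker_product A B * kronecker_product C D"
proof (rule eq_matI)
  note K = kronecker_product_carrier[OF A(1) B(1)] kronecker_product_carrier[OF A(2) B(2)]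
  have AC: "A * C \<in> carrier_mat n n" and BD: "B * D \<in> carrier_mat m m" using A B by auto
  fix a b
  assume "a < dim_row (kronecker_product A B * kronecker_product C D)"
    "b < dim_col (kronecker_product A B * kronecker_product C D)"
  then have ab: "a < n * m" "b < n * m" using K by auto
  note lt = div_mod_less[OF ab(1)] div_mod_less[OF ab(2)]
  have "(kronecker_product A B * kronecker_product C D) $$ (a, b) =
      (\<Sum>k<n * m. A $$ (a div m, k div m) * B $$ (a mod m, k mod m) *
        (C $$ (k div m, b div m) * D $$ (k mod m, b mod m)))"
    by (subst index_mult_mat_sum[OF K ab])
      (auto simp: kronecker_product_index[OF A(1) B(1) ab(1)]
        kronecker_product_index[OF A(2) B(2) _ ab(2)] intro!: sum.cong)
  also have "\<dots> = (\<Sum>i<n. \<Sum>j<m. A $$ (a div m, i) * B $$ (a mod m, j) *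
        (C $$ (i, b div m) * D $$ (j, b mod m)))"
    by (rule sum_div_mod)
  also have "\<dots> = (A * C) $$ (a div m, b div m) * (B * D) $$ (a mod m, b mod m)"
    unfolding index_mult_mat_sum[OF A lt(1,3)] index_mult_mat_sum[OF B lt(2,4)] sum_product
    by (simp add: ac_simps)
  finally show "kronecker_product (A * C) (B * D) $$ (a, b) =
      (kronecker_product A B * kronecker_product C D) $$ (a, b)"
    by (simp only: kronecker_product_index[OF AC BD ab])
qed (use A B in \<open>auto simp: kronecker_product_def\<close>)

lemma kronecker_product_one: "kronecker_product (1\<^sub>m n) (1\<^sub>m m) = 1\<^sub>m (n * m)"
proof (rule eq_matI)
  fix a b assume "a < dim_row (1\<^sub>m (n * m) :: 'a mat)" "b < dim_col (1\<^sub>m (n * m) :: 'a mat)"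
  then have ab: "a < n * m" "b < n * m" by auto
  have "a = b \<longleftrightarrow> a div m = b div m \<and> a mod m = b mod m" by (metis div_mult_mod_eq)
  then show "kronecker_product (1\<^sub>m n) (1\<^sub>m m) $$ (a, b) = (1\<^sub>m (n * m) :: 'a mat) $$ (a, b)"
    using div_mod_less[OF ab(1)] div_mod_less[OF ab(2)] ab
    by (auto simp: kronecker_product_index[of _ n n _ m m])
qed (auto simp: kronecker_product_def)

lemma trace_kronecker_product:
  assumes "A \<in> carrier_mat n n" "B \<in> carrier_mat m m"
  shows "trace_mat (kronecker_product A B) = trace_mat A * trace_mat B"
proof -
  have "trace_mat (kronecker_product A B) =
      (\<Sum>k<n * m. A $$ (k div m, k div m) * B $$ (k mod m, k mod m))"
    unfolding trace_mat_carrier[OF kronecker_product_carrier[OF assms]]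
    by (intro sum.cong) (auto simp: kronecker_product_index[OF assms])
  also have "\<dots> = (\<Sum>i<n. \<Sum>j<m. A $$ (i, i) * B $$ (j, j))"
    by (rule sum_div_mod)
  finally show ?thesis
    by (simp add: trace_mat_carrier[OF assms(1)] trace_mat_carrier[OF assms(2)] sum_product)
qed

lemma norm_root_of_unity:
  fixes d :: "'a :: real_normed_div_algebra"
  assumes "d ^ n = 1" "n > 0"
  shows "norm d = 1"
proof -
  have "norm d ^ n = 1" using assms(1) by (simp flip: norm_power)
  then show ?thesis using power_eq_imp_eq_base[of "norm d" n 1] assms(2) by simp
qed

subsection \<open>Representations and Schur's lemma\<close>

locale finite_group = group +
  assumes finite_carrier: "finite (carrier G)"
begin

text \<open>Invertibility of \<open>R g\<close> follows from the matrix equations, since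
  \<open>R (inv g)\<close> is its inverse. New representations can thus be verified by computing
  products only.\<close>

lemma representation_iff:
  "representation G n R \<longleftrightarrow>
     (\<forall>g\<in>carrier G. R g \<in> carrier_mat n n) \<and> R \<one> = 1\<^sub>m n \<and>
     (\<forall>g\<in>carrier G. \<forall>h\<in>carrier G. R (g \<otimes> h) = R g * R h)"
proof -
  interpret M: ring "ring_mat TYPE(complex) n ()" by (rule ring_mat)
  have GL: "group (general_linear n)" by (rule M.units_group)
  show ?thesis
  proof (intro iffI conjI ballI)
    assume "representation G n R"
    then have R: "R \<in> hom G (general_linear n)" by (simp add: representation_def)
    show "R g \<in> carrier_mat n n" if "g \<in> carrier G" for g
      using hom_in_carrier[OF R that] by (auto simp: units_of_def Units_def ring_mat_simps)
    show "R \<one> = 1\<^sub>m n"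
      using hom_one[OF R group_axioms GL] by (simp add: units_of_def ring_mat_simps)
    show "R (g \<otimes> h) = R g * R h" if "g \<in> carrier G" "h \<in> carrier G" for g h
      using hom_mult[OF R that] by (simp add: units_of_def ring_mat_simps)
  next
    assume R: "(\<forall>g\<in>carrier G. R g \<in> carrier_mat n n) \<and> R \<one> = 1\<^sub>m n \<and>
      (\<forall>g\<in>carrier G. \<forall>h\<in>carrier G. R (g \<otimes> h) = R g * R h)"
    have "R g \<in> Units (ring_mat TYPE(complex) n ())" if "g \<in> carrier G" for g
      using R that R[THEN conjunct2, THEN conjunct2, rule_format, of g "inv g"]
        R[THEN conjunct2, THEN conjunct2, rule_format, of "inv g" g]
      by (auto simp: Units_def ring_mat_simps intro!: bexI[of _ "R (inv g)"])
    then show "representation G n R"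
      using R by (auto simp: representation_def hom_def units_of_def ring_mat_simps)
  qed
qed

lemma rep_carrier: "representation G n R \<Longrightarrow> g \<in> carrier G \<Longrightarrow> R g \<in> carrier_mat n n"
  and rep_one: "representation G n R \<Longrightarrow> R \<one> = 1\<^sub>m n"
  and rep_mult: "representation G n R \<Longrightarrow> g \<in> carrier G \<Longrightarrow> h \<in> carrier G \<Longrightarrow> R (g \<otimes> h) = R g * R h"
  by (auto simp: representation_iff)

lemma rep_pow:
  assumes "representation G n R" "g \<in> carrier G"
  shows "R (g [^] k) = R g ^\<^sub>m (k :: nat)"
  using assms rep_carrier[OF assms]
  by (induction k) (auto simp: rep_one rep_mult)

lemma order_pos: "Coset.order G > 0"
  using finite_carrier one_closed by (auto simp: Coset.order_def card_gt_0_iff)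

lemma rep_trace_eigenvalues:
  assumes R: "representation G n R" and g: "g \<in> carrier G"
  obtains ds where "length ds = n" "\<And>d. d \<in> set ds \<Longrightarrow> d ^ Coset.order G = 1"
    "trace_mat (R g) = sum_list ds" "trace_mat (R (inv g)) = cnj (sum_list ds)"
proof -
  have "R g ^\<^sub>m Coset.order G = 1\<^sub>m n"
    using rep_pow[OF R g, of "Coset.order G"] pow_order_eq_1[OF g] rep_one[OF R] by simp
  from trace_pow_finite_order[OF rep_carrier[OF R g] this]
  obtain ds where ds: "length ds = n" "\<And>d. d \<in> set ds \<Longrightarrow> d ^ Coset.order G = 1"
    "\<And>k. trace_mat (R g ^\<^sub>m k) = (\<Sum>d\<leftarrow>ds. d ^ k)" by blast
  have "g [^] (Coset.order G - 1) \<otimes> g = \<one>"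
    using order_pos pow_order_eq_1[OF g] nat_pow_Suc[of g "Coset.order G - 1"] by simp
  \<comment> \<open>Writing the inverse as a natural power lets the same list \<open>ds\<close>
    compute its trace.\<close>
  then have inv: "inv g = g [^] (Coset.order G - 1)"
    using g by (intro inv_equality) auto
  \<comment> \<open>As \<open>d\<close> is a root of unity on the unit circle, both sides are the
    inverse of \<open>d\<close>.\<close>
  have "d ^ (Coset.order G - 1) = cnj d" if "d \<in> set ds" for d
  proof -
    have "norm d = 1"
      using ds(2)[OF that] order_pos norm_root_of_unity by blast
    then have "d * cnj d = 1" by (simp add: complex_norm_square[symmetric])
    moreover have "d * d ^ (Coset.order G - 1) = 1"
      using ds(2)[OF that] order_pos by (cases "Coset.order G") auto
    ultimately have "d * d ^ (Coset.order G - 1) = d * cnj d" "d \<noteq> 0" by auto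
    then show ?thesis by simp
  qed
  then have "(\<Sum>d\<leftarrow>ds. d ^ (Coset.order G - 1)) = (\<Sum>d\<leftarrow>ds. cnj d)"
    by (simp cong: map_cong)
  moreover have "(\<Sum>d\<leftarrow>xs. cnj d) = cnj (sum_list xs)" for xs :: "complex list"
    by (induction xs) auto
  ultimately have "trace_mat (R (inv g)) = cnj (sum_list ds)"
    using ds(3)[of "Coset.order G - 1"] by (simp add: inv rep_pow[OF R g])
  moreover have "trace_mat (R g) = sum_list ds"
    using ds(3)[of 1] rep_carrier[OF R g] by simp
  ultimately show ?thesis using that ds(1,2) by blast
qed

lemma norm_trace_rep_le:
  assumes "representation G n R" "g \<in> carrier G"
  shows "cmod (trace_mat (R g)) \<le> n"
proof -
  obtain ds where ds: "length ds = n" "\<And>d. d \<in> set ds \<Longrightarrow> d ^ Coset.order G = 1"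
    "trace_mat (R g) = sum_list ds"
    using rep_trace_eigenvalues[OF assms] by metis
  have "norm d = 1" if "d \<in> set ds" for d
    using ds(2)[OF that] order_pos norm_root_of_unity by blast
  then have "cmod (sum_list ds) \<le> length ds"
  proof (induction ds)
    case (Cons d ds)
    then show ?case using norm_triangle_ineq[of d "sum_list ds"] by simp
  qed simp
  with ds show ?thesis by simp
qed

section \<open>Schur's lemma\<close>

definition intertwiner ::
  "nat \<Rightarrow> (_ \<Rightarrow> complex mat) \<Rightarrow> nat \<Rightarrow> (_ \<Rightarrow> complex mat) \<Rightarrow> complex mat \<Rightarrow> bool" where
  "intertwiner n R m S A \<longleftrightarrow> A \<in> carrier_mat m n \<and> (\<forall>g\<in>carrier G. S g * A = A * R g)"

text \<open>Kernel and image of \<open>A\<close> are invariant subspaces. As \<open>A\<close> is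
  nonzero, the kernel is not the whole space and the image is not zero, so irreducibility leaves
  only a zero kernel and a full image.\<close>

lemma schur_invertible:
  assumes R: "irreducible_representation G n R" and S: "irreducible_representation G m S"
    and A: "intertwiner n R m S A" "A \<noteq> 0\<^sub>m m n"
  obtains B where "B \<in> carrier_mat n m" "A * B = 1\<^sub>m m" "B * A = 1\<^sub>m n"
proof -
  have Ac: "A \<in> carrier_mat m n" and AS: "\<And>g. g \<in> carrier G \<Longrightarrow> S g * A = A * R g"
    using A by (auto simp: intertwiner_def)
  have Rc: "\<And>g. g \<in> carrier G \<Longrightarrow> R g \<in> carrier_mat n n" and Sc: "\<And>g. g \<in> carrier G \<Longrightarrow> S g \<in> carrier_mat m m"
    using R S rep_carrier by (auto simp: irreducible_representation_def)
  have AR: "A *\<^sub>v (R g *\<^sub>v v) = S g *\<^sub>v (A *\<^sub>v v)" if "g \<in> carrier G" "v \<in> carrier_vec n" for g v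
    using AS[of g] Ac Rc[of g] Sc[of g] that
    by (metis assoc_mult_mat_vec)
  let ?K = "{v \<in> carrier_vec n. A *\<^sub>v v = 0\<^sub>v m}" and ?I = "(*\<^sub>v) A ` carrier_vec n"
  have "invariant_subspace G n R ?K"
    unfolding invariant_subspace_def subspace_vec_iff
  proof (intro conjI ballI allI)
    show "0\<^sub>v n \<in> ?K" using Ac by auto
    show "v + w \<in> ?K" if "v \<in> ?K" "w \<in> ?K" for v w
      using that Ac by (simp add: mult_add_distrib_mat_vec[of _ m n])
    show "c \<cdot>\<^sub>v v \<in> ?K" if "v \<in> ?K" for c v
      using that Ac by (auto simp: mult_mat_vec[of _ m n])
    show "R g *\<^sub>v w \<in> ?K" if "g \<in> carrier G" "w \<in> ?K" for g w
      using that Rc[of g] Sc[of g] by (auto simp: AR)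
  qed auto
  with R have "?K = {0\<^sub>v n} \<or> ?K = carrier_vec n"
    by (simp add: irreducible_representation_def)
  moreover have "?K \<noteq> carrier_vec n"
  proof
    assume K: "?K = carrier_vec n"
    have "A *\<^sub>v v = 0\<^sub>m m n *\<^sub>v v" if "v \<in> carrier_vec n" for v
    proof -
      have "A *\<^sub>v v = 0\<^sub>v m" using K that by blast
      then show ?thesis using that by (intro eq_vecI) auto
    qed
    then have "A = 0\<^sub>m m n" using Ac by (intro mat_eq_by_vec[of _ m n]) auto
    with A show False by simp
  qed
  ultimately have K: "?K = {0\<^sub>v n}" by blast
  have "invariant_subspace G m S ?I"
    unfolding invariant_subspace_def subspace_vec_iff
  proof (intro conjI ballI allI)
    show "0\<^sub>v m \<in> ?I" using Ac by (auto intro!: image_eqI[of _ _ "0\<^sub>v n"])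
    show "v + w \<in> ?I" if "v \<in> ?I" "w \<in> ?I" for v w
      using that Ac by (auto simp flip: mult_add_distrib_mat_vec)
    show "c \<cdot>\<^sub>v v \<in> ?I" if "v \<in> ?I" for c v
      using that Ac by (auto simp flip: mult_mat_vec)
    show "S g *\<^sub>v w \<in> ?I" if "g \<in> carrier G" "w \<in> ?I" for g w
      using that Rc[of g] by (auto simp flip: AR)
  qed (use Ac in auto)
  with S have "?I = {0\<^sub>v m} \<or> ?I = carrier_vec m"
    by (simp add: irreducible_representation_def)
  moreover have "?I \<noteq> {0\<^sub>v m}" using \<open>?K \<noteq> carrier_vec n\<close> by auto
  ultimately have I: "?I = carrier_vec m" by blast
  show ?thesis
  proof (rule bijective_mat_invertible[OF Ac _ _ that])
    show "v = 0\<^sub>v n" if "v \<in> carrier_vec n" "A *\<^sub>v v = 0\<^sub>v m" for v using K that by blast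
    show "\<exists>v\<in>carrier_vec n. A *\<^sub>v v = w" if "w \<in> carrier_vec m" for w
      using that unfolding I[symmetric] by auto
  qed
qed

text \<open>An invertible intertwiner makes \<open>R g\<close> and \<open>S g\<close> conjugate, so
  their traces agree. It is applied in contrapositive form: different characters admit only the zero
  intertwiner.\<close>

lemma schur_characters_eq:
  assumes R: "irreducible_representation G n R" and S: "irreducible_representation G m S"
    and A: "intertwiner n R m S A" "A \<noteq> 0\<^sub>m m n"
  shows "character G R = character G S"
proof -
  obtain B where B: "B \<in> carrier_mat n m" "A * B = 1\<^sub>m m" "B * A = 1\<^sub>m n"
    using schur_invertible[OF assms] .
  have Ac: "A \<in> carrier_mat m n" and AS: "\<And>g. g \<in> carrier G \<Longrightarrow> S g * A = A * R g"
    using A by (auto simp: intertwiner_def)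
  have Rc: "\<And>g. g \<in> carrier G \<Longrightarrow> R g \<in> carrier_mat n n" and Sc: "\<And>g. g \<in> carrier G \<Longrightarrow> S g \<in> carrier_mat m m"
    using R S rep_carrier by (auto simp: irreducible_representation_def)
  have "trace_mat (R g) = trace_mat (S g)" if g: "g \<in> carrier G" for g
  proof -
    have "B * S g * A = B * (A * R g)"
      using B Ac Sc[OF g] AS[OF g] by (simp add: assoc_mult_mat[of _ n m _ m _ n])
    also have "\<dots> = R g"
      using B Ac Rc[OF g] by (simp flip: assoc_mult_mat[of _ n m _ n _ n])
    finally have "R g = B * S g * A" ..
    then show ?thesis
      using trace_mat_conj[OF Sc[OF g] Ac B(1,2)] by simp
  qed
  then show ?thesis by (simp add: character_def cong: restrict_cong)
qed

text \<open>For an eigenvalue c of \<open>A\<close>, the matrix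
  \<open>A - c \<cdot>\<^sub>m 1\<^sub>m n\<close> is again an intertwiner. It kills an eigenvector,
  so it is not invertible and must be zero.\<close>

lemma schur_scalar:
  assumes R: "irreducible_representation G n R" and A: "intertwiner n R n R A"
  obtains c where "A = c \<cdot>\<^sub>m 1\<^sub>m n"
proof -
  have Ac: "A \<in> carrier_mat n n" and AS: "\<And>g. g \<in> carrier G \<Longrightarrow> R g * A = A * R g"
    using A by (auto simp: intertwiner_def)
  have n: "n > 0" and Rc: "\<And>g. g \<in> carrier G \<Longrightarrow> R g \<in> carrier_mat n n"
    using R rep_carrier by (auto simp: irreducible_representation_def)
  obtain c where "eigenvalue A c"
    using spectrum_non_empty[OF Ac n] by (auto simp: spectrum_def)
  then obtain v where v: "v \<in> carrier_vec n" "v \<noteq> 0\<^sub>v n" "A *\<^sub>v v = c \<cdot>\<^sub>v v"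
    using Ac by (auto simp: eigenvalue_def eigenvector_def)
  define C where "C = A - c \<cdot>\<^sub>m 1\<^sub>m n"
  have Cc: "C \<in> carrier_mat n n" using Ac by (auto simp: C_def)
  have Cv: "C *\<^sub>v v = 0\<^sub>v n"
  proof -
    have "(c \<cdot>\<^sub>m 1\<^sub>m n) *\<^sub>v v = c \<cdot>\<^sub>v v" using v by (intro eq_vecI) auto
    then show ?thesis using Ac v by (simp add: C_def minus_mult_distrib_mat_vec[of _ n n])
  qed
  have "intertwiner n R n R C"
    unfolding intertwiner_def
  proof (intro conjI ballI)
    fix g assume g: "g \<in> carrier G"
    have "R g * C = R g * A - c \<cdot>\<^sub>m R g"
      using Ac Rc[OF g] unfolding C_def
      by (subst mult_minus_distrib_mat[of _ n n _ n]) (auto simp: mult_smult_distrib[of _ n n _ n])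
    moreover have "C * R g = A * R g - c \<cdot>\<^sub>m R g"
      using Ac Rc[OF g] unfolding C_def
      by (subst minus_mult_distrib_mat[of _ n n _ _ n]) (auto simp: mult_smult_assoc_mat[of _ n n _ n])
    ultimately show "R g * C = C * R g" using AS[OF g] by simp
  qed (rule Cc)
  moreover have False if "B \<in> carrier_mat n n" "B * C = 1\<^sub>m n" for B
  proof -
    have "v = (B * C) *\<^sub>v v" using that v by simp
    also have "\<dots> = B *\<^sub>v (C *\<^sub>v v)" using that Cc v by (intro assoc_mult_mat_vec)
    also have "\<dots> = 0\<^sub>v n" unfolding Cv using that by auto
    finally show False using v by simp
  qed
  ultimately have "C = 0\<^sub>m n n" using schur_invertible[OF R R, of C] by metis
  then have "A = c \<cdot>\<^sub>m 1\<^sub>m n"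
    using Ac by (auto simp: C_def mat_eq_iff)
  then show ?thesis using that by blast
qed

subsection \<open>Orthogonality of irreducible characters\<close>

definition inner_class :: "(_ \<Rightarrow> complex) \<Rightarrow> (_ \<Rightarrow> complex) \<Rightarrow> complex" where
  "inner_class \<phi> \<psi> = (\<Sum>g\<in>carrier G. \<phi> g * cnj (\<psi> g))"

lemma sum_translate:
  assumes "h \<in> carrier G"
  shows "(\<Sum>g\<in>carrier G. f (h \<otimes> g)) = (\<Sum>g\<in>carrier G. f g)"
  using assms
  by (intro sum.reindex_bij_witness[of _ "\<lambda>g. inv h \<otimes> g" "\<lambda>g. h \<otimes> g"])
    (auto simp: inv_solve_left m_assoc[symmetric])

text \<open>The matrix is the sum over g of S(g) E R(inv g), with E the matrix unit at (i, j). Such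
  averages commute with the group action because the sum is invariant under translating g by
  h.\<close>

lemma coefficient_intertwiner:
  assumes R: "representation G n R" and S: "representation G m S" and ij: "i < m" "j < n"
  shows "intertwiner n R m S
    (mat m n (\<lambda>(a, b). \<Sum>g\<in>carrier G. S g $$ (a, i) * R (inv g) $$ (j, b)))"
    (is "intertwiner n R m S ?A")
  unfolding intertwiner_def
proof (intro conjI ballI)
  fix h assume h: "h \<in> carrier G"
  note Rc = rep_carrier[OF R] and Sc = rep_carrier[OF S]
  have A: "?A \<in> carrier_mat m n" by simp
  show "S h * ?A = ?A * R h"
  proof (rule eq_matI)
    fix a b assume "a < dim_row (?A * R h)" "b < dim_col (?A * R h)"
    then have ab: "a < m" "b < n" using Rc[OF h] by auto
    have "(S h * ?A) $$ (a, b) =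
        (\<Sum>k<m. \<Sum>g\<in>carrier G. S h $$ (a, k) * S g $$ (k, i) * R (inv g) $$ (j, b))"
      by (subst index_mult_mat_sum[OF Sc[OF h] A ab])
        (use ab in \<open>auto simp: sum_distrib_left mult.assoc intro!: sum.cong\<close>)
    also have "\<dots> = (\<Sum>g\<in>carrier G. S (h \<otimes> g) $$ (a, i) * R (inv g) $$ (j, b))"
      by (subst sum.swap, rule sum.cong, simp, subst rep_mult[OF S h], simp,
          subst index_mult_mat_sum[OF Sc[OF h] Sc ab(1) ij(1)])
        (auto simp: sum_distrib_right)
    \<comment> \<open>The summand becomes a function of \<open>h \<otimes> g\<close> alone, ready
      for translation; the \<open>h\<close> split off here yields the factor \<open>R h\<close> on
      the right.\<close>
    also have "\<dots> = (\<Sum>g\<in>carrier G. S (h \<otimes> g) $$ (a, i) * R (inv (h \<otimes> g) \<otimes> h) $$ (j, b))"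
      using h by (intro sum.cong) (auto simp: inv_mult_group m_assoc)
    also have "\<dots> = (\<Sum>g\<in>carrier G. S g $$ (a, i) * R (inv g \<otimes> h) $$ (j, b))"
      by (rule sum_translate[OF h, of "\<lambda>g. S g $$ (a, i) * R (inv g \<otimes> h) $$ (j, b)"])
    also have "\<dots> = (\<Sum>k<n. \<Sum>g\<in>carrier G. S g $$ (a, i) * R (inv g) $$ (j, k) * R h $$ (k, b))"
      by (subst sum.swap, rule sum.cong, simp, subst rep_mult[OF R _ h], simp,
          subst index_mult_mat_sum[OF Rc Rc[OF h] ij(2) ab(2)])
        (auto simp: sum_distrib_left mult.assoc)
    also have "\<dots> = (?A * R h) $$ (a, b)"
      by (subst index_mult_mat_sum[OF A Rc[OF h] ab])
        (use ab in \<open>auto simp: sum_distrib_right intro!: sum.cong\<close>)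
    finally show "(S h * ?A) $$ (a, b) = (?A * R h) $$ (a, b)" .
  qed (use Rc[OF h] Sc[OF h] in auto)
qed simp

lemma character_eq_trace: "g \<in> carrier G \<Longrightarrow> character G R g = trace_mat (R g)"
  by (simp add: character_def)

lemma character_inv:
  assumes "representation G n R" "g \<in> carrier G"
  shows "character G R (inv g) = cnj (character G R g)"
  using rep_trace_eigenvalues[OF assms] assms(2) by (metis character_eq_trace inv_closed)

text \<open>Conjugation of the character becomes inversion of g. The innermost sum is then entry (i,
  j) of the averaged matrix in \<open>coefficient_intertwiner\<close>, so Schur's lemma evaluates
  it.\<close>

lemma inner_characters:
  assumes R: "representation G n R" and S: "representation G m S"
  shows "inner_class (character G S) (character G R) =
    (\<Sum>i<m. \<Sum>j<n. \<Sum>g\<in>carrier G. S g $$ (i, i) * R (inv g) $$ (j, j))"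
proof -
  have "inner_class (character G S) (character G R) =
      (\<Sum>g\<in>carrier G. \<Sum>i<m. \<Sum>j<n. S g $$ (i, i) * R (inv g) $$ (j, j))"
    unfolding inner_class_def
  proof (rule sum.cong[OF refl])
    fix g assume g: "g \<in> carrier G"
    then have "cnj (character G R g) = trace_mat (R (inv g))"
      using character_inv[OF R g] by (simp add: character_eq_trace)
    then show "character G S g * cnj (character G R g) =
        (\<Sum>i<m. \<Sum>j<n. S g $$ (i, i) * R (inv g) $$ (j, j))"
      using g by (simp add: character_eq_trace sum_product
          trace_mat_carrier[OF rep_carrier[OF R]] trace_mat_carrier[OF rep_carrier[OF S]])
  qed
  then show ?thesis by (subst sum.swap) (auto intro!: sum.cong sum.swap)
qed

lemma irreducible_imp_rep: "irreducible_representation G n R \<Longrightarrow> representation G n R"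
  by (simp add: irreducible_representation_def)

lemma inner_irreducible_neq:
  assumes R: "irreducible_representation G n R" and S: "irreducible_representation G m S"
    and neq: "character G R \<noteq> character G S"
  shows "inner_class (character G S) (character G R) = 0"
proof -
  have "(\<Sum>g\<in>carrier G. S g $$ (i, i) * R (inv g) $$ (j, j)) = 0" if ij: "i < m" "j < n" for i j
  proof -
    let ?A = "mat m n (\<lambda>(a, b). \<Sum>g\<in>carrier G. S g $$ (a, i) * R (inv g) $$ (j, b))"
    have "?A = 0\<^sub>m m n"
      using schur_characters_eq[OF R S coefficient_intertwiner] irreducible_imp_rep R S ij neq
      by blast
    then have "?A $$ (i, j) = 0" using ij by simp
    then show ?thesis using ij by simp
  qed
  then show ?thesis
    by (simp add: inner_characters[OF irreducible_imp_rep[OF R] irreducible_imp_rep[OF S]])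
qed

text \<open>The averaged matrix is a scalar, so only the \<open>n\<close> pairs with i = j
  contribute, each giving |G| / n.\<close>

lemma inner_irreducible_self:
  assumes R: "irreducible_representation G n R"
  shows "inner_class (character G R) (character G R) = of_nat (Coset.order G)"
proof -
  have n: "n > 0" and rep: "representation G n R" using R by (auto simp: irreducible_representation_def)
  note Rc = rep_carrier[OF rep]
  have coeff: "(\<Sum>g\<in>carrier G. R g $$ (i, i) * R (inv g) $$ (j, j)) =
      (if i = j then of_nat (Coset.order G) / of_nat n else 0)" if ij: "i < n" "j < n" for i j
  proof -
    let ?A = "mat n n (\<lambda>(a, b). \<Sum>g\<in>carrier G. R g $$ (a, i) * R (inv g) $$ (j, b))"
    obtain c where c: "?A = c \<cdot>\<^sub>m 1\<^sub>m n"
      using schur_scalar[OF R coefficient_intertwiner[OF rep rep ij]] .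
    \<comment> \<open>The scalar is computed from the trace: summing over \<open>a\<close> collapses
      the coefficients to an entry of \<open>R (inv g \<otimes> g)\<close>, the identity
      matrix.\<close>
    have "of_nat n * c = trace_mat (c \<cdot>\<^sub>m 1\<^sub>m n)"
      by (simp add: trace_mat_def)
    also have "\<dots> = (\<Sum>a<n. \<Sum>g\<in>carrier G. R (inv g) $$ (j, a) * R g $$ (a, i))"
      unfolding c[symmetric] by (simp add: trace_mat_def mult.commute)
    also have "\<dots> = (\<Sum>g\<in>carrier G. R (inv g \<otimes> g) $$ (j, i))"
      by (subst sum.swap, rule sum.cong, simp, subst rep_mult[OF rep], simp, simp,
          subst index_mult_mat_sum[OF Rc Rc ij(2,1)]) auto
    also have "\<dots> = (\<Sum>g\<in>carrier G. if i = j then 1 else 0)"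
      using ij by (intro sum.cong) (auto simp: rep_one[OF rep])
    finally have "of_nat n * c = (if i = j then of_nat (Coset.order G) else 0)"
      by (simp add: Coset.order_def)
    moreover have "?A $$ (i, j) = (if i = j then c else 0)" unfolding c using ij by simp
    ultimately show ?thesis using ij n by (auto simp: field_simps split: if_splits)
  qed
  then show ?thesis
    using n by (simp add: inner_characters[OF rep rep])
qed

lemma Irr_E:
  assumes "\<chi> \<in> Irr G"
  obtains n R where "irreducible_representation G n R" "\<chi> = character G R"
  using assms by (auto simp: Irr_def)

lemma Irr_orthogonality:
  assumes "\<chi> \<in> Irr G" "\<psi> \<in> Irr G"
  shows "inner_class \<chi> \<psi> = (if \<chi> = \<psi> then of_nat (Coset.order G) else 0)"
  using assms by (metis Irr_E inner_irreducible_neq inner_irreducible_self)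

lemma Irr_one:
  assumes "irreducible_representation G n R"
  shows "character G R \<one> = of_nat n"
  using rep_one[OF irreducible_imp_rep[OF assms]] by (simp add: character_eq_trace trace_mat_def)

lemma Irr_norm_le:
  assumes "\<chi> \<in> Irr G" "g \<in> carrier G"
  shows "cmod (\<chi> g) \<le> Re (\<chi> \<one>)"
proof -
  obtain n R where R: "irreducible_representation G n R" and \<chi>: "\<chi> = character G R"
    using assms(1) by (rule Irr_E)
  show ?thesis
    using norm_trace_rep_le[OF irreducible_imp_rep[OF R] assms(2)] assms(2)
    by (simp add: \<chi> Irr_one[OF R]) (simp add: character_eq_trace)
qed

text \<open>A degree is at most \<open>|G|\<close> since its square is one term of \<open>\<langle>\<chi>, \<chi>\<rangle> = |G|\<close>, and a value is a sum of
  as many \<open>|G|\<close>-th roots of unity as the degree says; this leaves finitely many candidates.\<close>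

lemma finite_Irr: "finite (Irr G)"
proof -
  let ?N = "Coset.order G"
  let ?roots = "{d :: complex. d ^ ?N = 1}"
  let ?V = "sum_list ` {ds. set ds \<subseteq> ?roots \<and> length ds \<le> ?N}"
  have "finite ?V"
    using order_pos by (intro finite_imageI finite_lists_length_le finite_roots_unity) auto
  moreover have "Irr G \<subseteq> (carrier G \<rightarrow>\<^sub>E ?V)"
  proof
    fix \<chi> assume "\<chi> \<in> Irr G"
    then obtain n R where R: "irreducible_representation G n R" and \<chi>: "\<chi> = character G R"
      by (rule Irr_E)
    have "real n ^ 2 = (cmod (\<chi> \<one>))\<^sup>2" using Irr_one[OF R] \<chi> by simp
    also have "\<dots> \<le> (\<Sum>g\<in>carrier G. (cmod (\<chi> g))\<^sup>2)"
      using finite_carrier by (intro member_le_sum) auto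
    also have "\<dots> = Re (inner_class \<chi> \<chi>)"
      by (simp add: inner_class_def flip: complex_norm_square)
    also have "\<dots> = real ?N" using inner_irreducible_self[OF R] \<chi> by simp
    finally have "n ^ 2 \<le> ?N" by (metis of_nat_le_iff of_nat_power)
    then have n: "n \<le> ?N" using self_le_power[of n 2]
      by (metis le_trans bot_nat_0.extremum not_less_eq_eq One_nat_def pos2)
    have "\<chi> g \<in> ?V" if g: "g \<in> carrier G" for g
    proof -
      obtain ds where ds: "length ds = n" "\<And>d. d \<in> set ds \<Longrightarrow> d ^ ?N = 1"
          "trace_mat (R g) = sum_list ds"
        using rep_trace_eigenvalues[OF irreducible_imp_rep[OF R] g] by metis
      then show ?thesis
        using n g by (auto simp: \<chi> character_eq_trace intro!: imageI)
    qed
    \<comment> \<open>Characters are \<open>undefined\<close> off the carrier, so finitely many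
      values on the carrier leave finitely many functions.\<close>
    then show "\<chi> \<in> carrier G \<rightarrow>\<^sub>E ?V" by (auto simp: \<chi> character_def)
  qed
  ultimately show ?thesis
    using finite_carrier by (meson finite_PiE finite_subset)
qed

subsection \<open>Decomposition into irreducible characters\<close>

lemma representation_kronecker:
  assumes R: "representation G n R" and S: "representation G m S"
  shows "representation G (n * m) (\<lambda>g. kronecker_product (R g) (S g))"
  unfolding representation_iff
  using kronecker_product_carrier[OF rep_carrier[OF R] rep_carrier[OF S]]
    kronecker_product_mult[OF rep_carrier[OF R] rep_carrier[OF R] rep_carrier[OF S] rep_carrier[OF S]]
  by (auto simp: rep_one[OF R] rep_one[OF S] rep_mult[OF R] rep_mult[OF S] kronecker_product_one)

lemma representation_conj:
  assumes R: "representation G n R" and P: "P \<in> carrier_mat n n" and Q: "Q \<in> carrier_mat n n"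
    and inv: "P * Q = 1\<^sub>m n" "Q * P = 1\<^sub>m n"
  shows "representation G n (\<lambda>g. Q * R g * P)"
  unfolding representation_iff
proof (intro conjI ballI)
  show "Q * R \<one> * P = 1\<^sub>m n" using Q inv by (simp add: rep_one[OF R])
  fix g assume g: "g \<in> carrier G"
  then show "Q * R g * P \<in> carrier_mat n n" using P Q rep_carrier[OF R g] by simp
  fix h assume h: "h \<in> carrier G"
  note c = P Q rep_carrier[OF R g] rep_carrier[OF R h]
  have "Q * R g * P * (Q * R h * P) = Q * R g * (P * Q) * (R h * P)"
    using c by (simp add: assoc_mult_mat[of _ n n _ n _ n] mult_carrier_mat[of _ n n])
  also have "\<dots> = Q * R (g \<otimes> h) * P"
    unfolding inv rep_mult[OF R g h]
    using c by (simp add: assoc_mult_mat[of _ n n _ n _ n] mult_carrier_mat[of _ n n])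
  finally show "Q * R (g \<otimes> h) * P = Q * R g * P * (Q * R h * P)" ..
qed

text \<open>For an invariant subspace the two blocks are the subrepresentation and the quotient.
  Splitting the sum for a product entry at \<open>d\<close>, the half that leaves the diagonal block
  contains a zero factor.\<close>

lemma representation_blocks:
  assumes M: "representation G (d + e) M"
    and zero: "\<And>g i j. g \<in> carrier G \<Longrightarrow> i < e \<Longrightarrow> j < d \<Longrightarrow> M g $$ (i + d, j) = 0"
  shows "representation G d (\<lambda>g. mat d d (\<lambda>(i, j). M g $$ (i, j)))" (is "representation G d ?A")
    and "representation G e (\<lambda>g. mat e e (\<lambda>(i, j). M g $$ (i + d, j + d)))" (is "representation G e ?D")
    and "g \<in> carrier G \<Longrightarrow> trace_mat (M g) = trace_mat (mat d d (\<lambda>(i, j). M g $$ (i, j))) +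
      trace_mat (mat e e (\<lambda>(i, j). M g $$ (i + d, j + d)))"
proof -
  note Mc = rep_carrier[OF M]
  have prod: "M (g \<otimes> h) $$ (i, j) = (\<Sum>k<d. M g $$ (i, k) * M h $$ (k, j)) +
      (\<Sum>k<e. M g $$ (i, k + d) * M h $$ (k + d, j))"
    if "g \<in> carrier G" "h \<in> carrier G" "i < d + e" "j < d + e" for g h i j
    unfolding rep_mult[OF M that(1,2)] index_mult_mat_sum[OF Mc[OF that(1)] Mc[OF that(2)] that(3,4)]
      sum_lessThan_split ..
  show "representation G d ?A"
    unfolding representation_iff
  proof (intro conjI ballI)
    show "?A (g \<otimes> h) = ?A g * ?A h" if "g \<in> carrier G" "h \<in> carrier G" for g h
      using that by (intro eq_matI)
        (auto simp: index_mult_mat_sum[of _ d d _ d] prod zero simp del: index_mult_mat(1))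
  qed (auto simp: rep_one[OF M])
  show "representation G e ?D"
    unfolding representation_iff
  proof (intro conjI ballI)
    show "?D (g \<otimes> h) = ?D g * ?D h" if "g \<in> carrier G" "h \<in> carrier G" for g h
      using that by (intro eq_matI)
        (auto simp: index_mult_mat_sum[of _ e e _ e] prod zero simp del: index_mult_mat(1))
  qed (auto simp: rep_one[OF M])
  show "trace_mat (M g) = trace_mat (mat d d (\<lambda>(i, j). M g $$ (i, j))) +
      trace_mat (mat e e (\<lambda>(i, j). M g $$ (i + d, j + d)))" if "g \<in> carrier G"
    by (simp add: trace_mat_carrier[OF Mc[OF that]] sum_lessThan_split trace_mat_carrier[of _ d d]
        trace_mat_carrier[of _ e e])
qed

text \<open>Induction on the dimension: a reducible representation is conjugated into block
  triangular form, and the traces of its two smaller diagonal blocks add up.\<close>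

lemma trace_decomposition:
  assumes "representation G n R"
  shows "\<exists>m :: (_ \<Rightarrow> complex) \<Rightarrow> nat. \<forall>g\<in>carrier G. trace_mat (R g) = (\<Sum>\<chi>\<in>Irr G. of_nat (m \<chi>) * \<chi> g)"
  using assms
proof (induction n arbitrary: R rule: less_induct)
  case (less n)
  note R = less.prems
  consider "n = 0" | "irreducible_representation G n R" | "n > 0" "\<not> irreducible_representation G n R"
    by blast
  then show ?case
  proof cases
    case 1
    \<comment> \<open>Dimension zero is a case of its own because irreducibility demands a positive
      dimension; the trace is an empty sum.\<close>
    then have "trace_mat (R g) = (\<Sum>\<chi>\<in>Irr G. of_nat 0 * \<chi> g)" if "g \<in> carrier G" for g
      using rep_carrier[OF R that] by (simp add: trace_mat_def)
    then show ?thesis by (intro exI[of _ "\<lambda>_. 0"]) auto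
  next
    case 2
    then have mem: "character G R \<in> Irr G" by (auto simp: Irr_def)
    have "trace_mat (R g) = (\<Sum>\<chi>\<in>Irr G. of_nat (if \<chi> = character G R then 1 else 0) * \<chi> g)"
      if "g \<in> carrier G" for g
    proof -
      have "(\<Sum>\<chi>\<in>Irr G. of_nat (if \<chi> = character G R then 1 else 0) * \<chi> g) =
          (\<Sum>\<chi>\<in>Irr G. if \<chi> = character G R then \<chi> g else 0)"
        by (intro sum.cong) auto
      then show ?thesis using mem finite_Irr character_eq_trace[OF that] by simp
    qed
    then show ?thesis
      by (intro exI[of _ "\<lambda>\<chi>. if \<chi> = character G R then 1 else 0"]) blast
  next
    case 3
    then obtain W where W: "invariant_subspace G n R W" "W \<noteq> {0\<^sub>v n}" "W \<noteq> carrier_vec n"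
      using R by (auto simp: irreducible_representation_def)
    then obtain P Q d where PQ: "P \<in> carrier_mat n n" "Q \<in> carrier_mat n n" "P * Q = 1\<^sub>m n"
        "Q * P = 1\<^sub>m n" and d: "0 < d" "d < n" and colP: "\<And>j. j < d \<Longrightarrow> col P j \<in> W"
        and zero: "\<And>w i. w \<in> W \<Longrightarrow> d \<le> i \<Longrightarrow> i < n \<Longrightarrow> (Q *\<^sub>v w) $ i = 0"
      using adapted_basis[of W n] by (auto simp: invariant_subspace_def)
    define e where "e = n - d"
    have n: "n = d + e" and e: "e < n" using d by (auto simp: e_def)
    define M where "M = (\<lambda>g. Q * R g * P)"
    have M: "representation G (d + e) M"
      using representation_conj[OF R PQ] by (simp add: M_def n)
    \<comment> \<open>Column \<open>j\<close> of \<open>M g\<close> holds the adapted coordinates of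
      \<open>R g *\<^sub>v col P j\<close>, which lies in \<open>W\<close> by invariance.\<close>
    have Mzero: "M g $$ (i + d, j) = 0" if g: "g \<in> carrier G" and ij: "i < e" "j < d" for g i j
    proof -
      have "col (M g) j = Q *\<^sub>v (R g *\<^sub>v col P j)"
      proof -
        note c = rep_carrier[OF R g]
        have "M g = Q * (R g * P)"
          using PQ c by (simp add: M_def assoc_mult_mat[of _ n n _ n _ n])
        moreover have "col (Q * (R g * P)) j = Q *\<^sub>v col (R g * P) j"
          using PQ c ij n by (intro col_mult2[of _ n n _ n]) auto
        moreover have "col (R g * P) j = R g *\<^sub>v col P j"
          using PQ c ij n by (intro col_mult2[of _ n n _ n]) auto
        ultimately show ?thesis by simp
      qed
      moreover have "R g *\<^sub>v col P j \<in> W"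
        using W colP[OF ij(2)] g by (auto simp: invariant_subspace_def)
      ultimately have "col (M g) j $ (i + d) = 0" using zero ij n by simp
      then show ?thesis using rep_carrier[OF M g] ij n by simp
    qed
    note blocks = representation_blocks[OF M Mzero]
    obtain m1 where m1: "\<And>g. g \<in> carrier G \<Longrightarrow> trace_mat (mat d d (\<lambda>(i, j). M g $$ (i, j))) =
        (\<Sum>\<chi>\<in>Irr G. of_nat (m1 \<chi>) * \<chi> g)"
      using less.IH[OF d(2) blocks(1)] by blast
    obtain m2 where m2: "\<And>g. g \<in> carrier G \<Longrightarrow>
        trace_mat (mat e e (\<lambda>(i, j). M g $$ (i + d, j + d))) = (\<Sum>\<chi>\<in>Irr G. of_nat (m2 \<chi>) * \<chi> g)"
      using less.IH[OF e blocks(2)] by blast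
    have "trace_mat (R g) = (\<Sum>\<chi>\<in>Irr G. of_nat (m1 \<chi> + m2 \<chi>) * \<chi> g)" if g: "g \<in> carrier G" for g
    proof -
      have "trace_mat (R g) = trace_mat (M g)"
        unfolding M_def using trace_mat_conj[OF rep_carrier[OF R g] PQ(1-3)] by simp
      then show ?thesis
        using blocks(3)[OF _ _ _ g] m1[OF g] m2[OF g]
        by (simp add: distrib_right sum.distrib)
    qed
    then show ?thesis by (intro exI[of _ "\<lambda>\<chi>. m1 \<chi> + m2 \<chi>"]) auto
  qed
qed

section \<open>Coefficients of expansions in irreducible characters\<close>

text \<open>Orthogonality extracts the coefficient. This serves both the uniqueness of Kronecker
  multiplicities and their formula as inner products.\<close>

lemma inner_Irr_combination:
  assumes f: "\<And>x. x \<in> carrier G \<Longrightarrow> f x = (\<Sum>\<chi>\<in>Irr G. c \<chi> * \<chi> x)" and \<rho>: "\<rho> \<in> Irr G"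
  shows "inner_class f \<rho> = c \<rho> * of_nat (Coset.order G)"
proof -
  have "inner_class f \<rho> = (\<Sum>x\<in>carrier G. \<Sum>\<chi>\<in>Irr G. c \<chi> * (\<chi> x * cnj (\<rho> x)))"
    unfolding inner_class_def by (intro sum.cong) (auto simp: f sum_distrib_right mult.assoc)
  also have "\<dots> = (\<Sum>\<chi>\<in>Irr G. c \<chi> * inner_class \<chi> \<rho>)"
    by (subst sum.swap) (simp add: inner_class_def sum_distrib_left)
  also have "\<dots> = (\<Sum>\<chi>\<in>Irr G. if \<chi> = \<rho> then c \<rho> * of_nat (Coset.order G) else 0)"
    using \<rho> by (intro sum.cong) (auto simp: Irr_orthogonality)
  also have "\<dots> = c \<rho> * of_nat (Coset.order G)"
    using \<rho> finite_Irr by simp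
  finally show ?thesis .
qed

text \<open>Parseval's identity. Only the first argument of the inner product is expanded; what
  remains is the conjugate of an extracted coefficient.\<close>

lemma inner_Irr_combination_self:
  assumes f: "\<And>x. x \<in> carrier G \<Longrightarrow> f x = (\<Sum>\<chi>\<in>Irr G. c \<chi> * \<chi> x)"
  shows "(\<Sum>x\<in>carrier G. (cmod (f x))\<^sup>2) = (\<Sum>\<chi>\<in>Irr G. (cmod (c \<chi>))\<^sup>2) * Coset.order G"
proof -
  have conj: "inner_class \<chi> f = cnj (inner_class f \<chi>)" for \<chi>
    by (simp add: inner_class_def mult.commute)
  have "inner_class f f = (\<Sum>x\<in>carrier G. \<Sum>\<chi>\<in>Irr G. c \<chi> * (\<chi> x * cnj (f x)))"
    unfolding inner_class_def
  proof (rule sum.cong[OF refl])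
    fix x assume "x \<in> carrier G"
    \<comment> \<open>The congruence rule confines the expansion to the first factor, leaving
      \<open>cnj (f x)\<close> intact.\<close>
    then have "f x * cnj (f x) = (\<Sum>\<chi>\<in>Irr G. c \<chi> * \<chi> x) * cnj (f x)"
      by (intro arg_cong2[where f = "(*)"] f refl)
    then show "f x * cnj (f x) = (\<Sum>\<chi>\<in>Irr G. c \<chi> * (\<chi> x * cnj (f x)))"
      by (simp only: sum_distrib_right mult.assoc)
  qed
  also have "\<dots> = (\<Sum>\<chi>\<in>Irr G. c \<chi> * inner_class \<chi> f)"
    by (subst sum.swap) (simp add: inner_class_def sum_distrib_left)
  also have "\<dots> = (\<Sum>\<chi>\<in>Irr G. c \<chi> * cnj (c \<chi>) * of_nat (Coset.order G))"
  proof (rule sum.cong[OF refl])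
    fix \<chi> assume "\<chi> \<in> Irr G"
    with f have "inner_class f \<chi> = c \<chi> * of_nat (Coset.order G)" by (rule inner_Irr_combination)
    then show "c \<chi> * inner_class \<chi> f = c \<chi> * cnj (c \<chi>) * of_nat (Coset.order G)"
      by (simp add: conj)
  qed
  finally have "complex_of_real (\<Sum>x\<in>carrier G. (cmod (f x))\<^sup>2) =
      complex_of_real ((\<Sum>\<chi>\<in>Irr G. (cmod (c \<chi>))\<^sup>2) * Coset.order G)"
    by (simp only: inner_class_def of_real_sum of_real_mult of_real_of_nat_eq complex_norm_square
        sum_distrib_right)
  then show ?thesis by (simp only: of_real_eq_iff)
qed

text \<open>The definite description in \<open>kronecker_mult\<close> has its intended meaning once
  existence and uniqueness are shown. Existence comes from decomposing the tensor product
  representation, uniqueness from orthogonality on \<open>Irr G\<close> and the support condition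
  elsewhere.\<close>

lemma kronecker_mult_decomposition:
  assumes "\<phi> \<in> Irr G" "\<psi> \<in> Irr G" "x \<in> carrier G"
  shows "\<phi> x * \<psi> x = (\<Sum>\<chi>\<in>Irr G. of_nat (kronecker_mult G \<chi> \<phi> \<psi>) * \<chi> x)"
proof -
  let ?P = "\<lambda>m :: (_ \<Rightarrow> complex) \<Rightarrow> nat. (\<forall>\<chi>. \<chi> \<notin> Irr G \<longrightarrow> m \<chi> = 0) \<and>
    (\<forall>x\<in>carrier G. \<phi> x * \<psi> x = (\<Sum>\<chi>\<in>Irr G. of_nat (m \<chi>) * \<chi> x))"
  obtain n R where R: "irreducible_representation G n R" "\<phi> = character G R"
    using assms(1) by (rule Irr_E)
  obtain n' S where S: "irreducible_representation G n' S" "\<psi> = character G S"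
    using assms(2) by (rule Irr_E)
  note reps = irreducible_imp_rep[OF R(1)] irreducible_imp_rep[OF S(1)]
  obtain m :: "(_ \<Rightarrow> complex) \<Rightarrow> nat" where m: "\<And>g. g \<in> carrier G \<Longrightarrow>
      trace_mat (kronecker_product (R g) (S g)) = (\<Sum>\<chi>\<in>Irr G. of_nat (m \<chi>) * \<chi> g)"
    using trace_decomposition[OF representation_kronecker[OF reps]] by blast
  have "\<phi> g * \<psi> g = (\<Sum>\<chi>\<in>Irr G. of_nat (if \<chi> \<in> Irr G then m \<chi> else 0) * \<chi> g)"
    if g: "g \<in> carrier G" for g
  proof -
    have "\<phi> g * \<psi> g = trace_mat (kronecker_product (R g) (S g))"
      unfolding R(2) S(2) character_eq_trace[OF g]
        trace_kronecker_product[OF rep_carrier[OF reps(1) g] rep_carrier[OF reps(2) g]] ..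
    then show ?thesis unfolding m[OF g] by simp
  qed
  then have ex: "?P (\<lambda>\<chi>. if \<chi> \<in> Irr G then m \<chi> else 0)" by simp
  have "m1 = m2" if "?P m2" "?P m1" for m1 m2
  proof
    fix \<chi>
    show "m1 \<chi> = m2 \<chi>"
    proof (cases "\<chi> \<in> Irr G")
      case True
      have "inner_class (\<lambda>x. \<phi> x * \<psi> x) \<chi> = of_nat (m1 \<chi>) * of_nat (Coset.order G)"
        using that(2) True by (intro inner_Irr_combination) auto
      moreover have "inner_class (\<lambda>x. \<phi> x * \<psi> x) \<chi> = of_nat (m2 \<chi>) * of_nat (Coset.order G)"
        using that(1) True by (intro inner_Irr_combination) auto
      ultimately show ?thesis using order_pos by simp
    next
      case False
      then show ?thesis using that by simp
    qed
  qed
  from ex1I[of ?P, OF ex this[OF ex]] have "\<exists>!m. ?P m" .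
  from theI'[OF this, THEN conjunct2, rule_format, OF assms(3)] show ?thesis
    unfolding kronecker_mult_def .
qed

text \<open>It makes \<open>Irr G\<close> nonempty, so that both maxima are attained and k(G) is
  positive.\<close>

lemma trivial_character_in_Irr: "character G (\<lambda>_. 1\<^sub>m 1) \<in> Irr G"
proof -
  have "representation G 1 (\<lambda>_. 1\<^sub>m 1)" by (simp add: representation_iff)
  moreover have "W = {0\<^sub>v 1} \<or> W = carrier_vec 1"
    if W: "invariant_subspace G 1 (\<lambda>_. 1\<^sub>m 1) W" for W
  proof (cases "W = {0\<^sub>v 1}")
    case False
    have sub: "W \<subseteq> carrier_vec 1" "0\<^sub>v 1 \<in> W" "\<And>c v. v \<in> W \<Longrightarrow> c \<cdot>\<^sub>v v \<in> W"
      using W by (auto simp: invariant_subspace_def subspace_vec_iff)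
    then obtain w where w: "w \<in> W" "w \<noteq> 0\<^sub>v 1" using False by blast
    then have w0: "w $ 0 \<noteq> 0" and wc: "w \<in> carrier_vec 1" using sub(1) by (auto simp: vec_eq_iff)
    \<comment> \<open>In dimension one every vector is a multiple of the nonzero
      \<open>w\<close>.\<close>
    have "v \<in> W" if "v \<in> carrier_vec 1" for v
    proof -
      have "v = (v $ 0 / w $ 0) \<cdot>\<^sub>v w" using that w0 wc by (auto simp: vec_eq_iff)
      then show ?thesis using sub(3)[OF w(1)] by metis
    qed
    then show ?thesis using sub(1) by blast
  qed simp
  ultimately have "irreducible_representation G 1 (\<lambda>_. 1\<^sub>m 1)"
    by (simp add: irreducible_representation_def)
  then show ?thesis by (auto simp: Irr_def)
qed

subsection \<open>Bounds for Kronecker multiplicities\<close>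

lemma degree_le_max_degree:
  assumes "\<chi> \<in> Irr G"
  shows "Re (\<chi> \<one>) \<le> max_degree G"
  unfolding max_degree_def
  using assms finite_Irr by (intro Max_ge) (auto simp: setcompr_eq_image)

lemma max_degree_attained:
  obtains \<chi> where "\<chi> \<in> Irr G" "Re (\<chi> \<one>) = max_degree G"
proof -
  have "max_degree G \<in> {Re (\<rho> \<one>) | \<rho>. \<rho> \<in> Irr G}"
    unfolding max_degree_def
    using finite_Irr trivial_character_in_Irr by (intro Max_in) (auto simp: setcompr_eq_image)
  then show ?thesis using that by auto
qed

text \<open>As an image of a finite nonempty product, the set has a genuine maximum.\<close>

lemma kronecker_mult_set:
  "{kronecker_mult G \<rho> \<phi> \<psi> | \<rho> \<phi> \<psi>. \<rho> \<in> Irr G \<and> \<phi> \<in> Irr G \<and> \<psi> \<in> Irr G} =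
     (\<lambda>(\<rho>, \<phi>, \<psi>). kronecker_mult G \<rho> \<phi> \<psi>) ` (Irr G \<times> Irr G \<times> Irr G)"
  by force

lemma kronecker_mult_le_max:
  assumes "\<rho> \<in> Irr G" "\<phi> \<in> Irr G" "\<psi> \<in> Irr G"
  shows "kronecker_mult G \<rho> \<phi> \<psi> \<le> max_kronecker_mult G"
  unfolding max_kronecker_mult_def kronecker_mult_set
  using assms finite_Irr by (intro Max_ge) (auto intro!: image_eqI[of _ _ "(\<rho>, \<phi>, \<psi>)"])

lemma max_kronecker_mult_attained:
  obtains \<rho> \<phi> \<psi> where "\<rho> \<in> Irr G" "\<phi> \<in> Irr G" "\<psi> \<in> Irr G"
    "kronecker_mult G \<rho> \<phi> \<psi> = max_kronecker_mult G"
proof -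
  have "max_kronecker_mult G \<in> {kronecker_mult G \<rho> \<phi> \<psi> | \<rho> \<phi> \<psi>. \<rho> \<in> Irr G \<and> \<phi> \<in> Irr G \<and> \<psi> \<in> Irr G}"
    unfolding max_kronecker_mult_def kronecker_mult_set
    using finite_Irr trivial_character_in_Irr by (intro Max_in) auto
  then show ?thesis using that by auto
qed

lemma Irr_sum_norm_square:
  assumes "\<chi> \<in> Irr G"
  shows "(\<Sum>x\<in>carrier G. (cmod (\<chi> x))\<^sup>2) = Coset.order G"
proof -
  have "complex_of_real (\<Sum>x\<in>carrier G. (cmod (\<chi> x))\<^sup>2) = inner_class \<chi> \<chi>"
    by (simp only: inner_class_def of_real_sum complex_norm_square)
  also have "\<dots> = complex_of_real (Coset.order G)" using assms by (simp add: Irr_orthogonality)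
  finally show ?thesis by (simp only: of_real_eq_iff)
qed

lemma kronecker_mult_le_degree:
  assumes \<rho>: "\<rho> \<in> Irr G" and \<phi>: "\<phi> \<in> Irr G" and \<psi>: "\<psi> \<in> Irr G"
  shows "real (kronecker_mult G \<rho> \<phi> \<psi>) \<le> Re (\<phi> \<one>)"
proof -
  let ?N = "real (Coset.order G)"
  have deg: "Re (\<phi> \<one>) \<ge> 0" using Irr_norm_le[OF \<phi> one_closed] norm_ge_zero order_trans by blast
  have "inner_class (\<lambda>x. \<phi> x * \<psi> x) \<rho> = of_nat (kronecker_mult G \<rho> \<phi> \<psi>) * of_nat (Coset.order G)"
    using kronecker_mult_decomposition[OF \<phi> \<psi>] \<rho> by (rule inner_Irr_combination)
  then have "real (kronecker_mult G \<rho> \<phi> \<psi>) * ?N = cmod (inner_class (\<lambda>x. \<phi> x * \<psi> x) \<rho>)"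
    by (simp add: norm_mult)
  also have "\<dots> \<le> (\<Sum>x\<in>carrier G. cmod (\<phi> x) * (cmod (\<psi> x) * cmod (\<rho> x)))"
    unfolding inner_class_def by (rule order_trans[OF norm_sum]) (simp add: norm_mult mult.assoc)
  \<comment> \<open>Both \<psi> and \<rho> have squared length |G|, so AM-GM loses nothing against
    Cauchy-Schwarz here.\<close>
  also have "\<dots> \<le> (\<Sum>x\<in>carrier G. Re (\<phi> \<one>) * (((cmod (\<psi> x))\<^sup>2 + (cmod (\<rho> x))\<^sup>2) / 2))"
  proof (intro sum_mono mult_mono)
    show "cmod (\<psi> x) * cmod (\<rho> x) \<le> ((cmod (\<psi> x))\<^sup>2 + (cmod (\<rho> x))\<^sup>2) / 2" for x
      using sum_squares_bound[of "cmod (\<psi> x)" "cmod (\<rho> x)"] by simp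
  qed (use Irr_norm_le[OF \<phi>] deg in auto)
  also have "\<dots> = Re (\<phi> \<one>) * ?N"
    using Irr_sum_norm_square[OF \<psi>] Irr_sum_norm_square[OF \<rho>]
    by (simp flip: sum_distrib_left sum_divide_distrib add: sum.distrib)
  finally show ?thesis using order_pos by simp
qed

lemma max_degree_pow4_le:
  "max_degree G ^ 4 \<le> real (num_irr G) * real (Coset.order G) * (real (max_kronecker_mult G))\<^sup>2"
proof -
  obtain \<phi> where \<phi>: "\<phi> \<in> Irr G" "Re (\<phi> \<one>) = max_degree G" by (rule max_degree_attained)
  have b: "max_degree G \<ge> 0"
    using Irr_norm_le[OF \<phi>(1) one_closed] norm_ge_zero \<phi>(2) order_trans by metis
  have "max_degree G ^ 4 \<le> (cmod (\<phi> \<one>)) ^ 4"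
    using b complex_Re_le_cmod[of "\<phi> \<one>"] \<phi>(2) by (intro power_mono) auto
  also have "\<dots> = (cmod (\<phi> \<one> * \<phi> \<one>))\<^sup>2"
    by (simp add: norm_mult power4_eq_xxxx power2_eq_square)
  \<comment> \<open>The identity contributes one of the nonnegative summands; Parseval then
    evaluates the whole sum.\<close>
  also have "\<dots> \<le> (\<Sum>x\<in>carrier G. (cmod (\<phi> x * \<phi> x))\<^sup>2)"
    using finite_carrier by (intro member_le_sum[of \<one>]) auto
  also have "\<dots> = (\<Sum>\<chi>\<in>Irr G. (cmod (of_nat (kronecker_mult G \<chi> \<phi> \<phi>)))\<^sup>2) * Coset.order G"
    using kronecker_mult_decomposition[OF \<phi>(1) \<phi>(1)] by (rule inner_Irr_combination_self)
  also have "\<dots> \<le> (\<Sum>\<chi>\<in>Irr G. (real (max_kronecker_mult G))\<^sup>2) * Coset.order G"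
    using \<phi> kronecker_mult_le_max by (intro mult_right_mono sum_mono) (auto intro!: power_mono)
  also have "\<dots> = real (num_irr G) * real (Coset.order G) * (real (max_kronecker_mult G))\<^sup>2"
    by (simp add: num_irr_def)
  finally show ?thesis .
qed

end

theorem theorem1p1:
  fixes G :: "('g, 'r) monoid_scheme"
  assumes "group G" and "finite (carrier G)"
  shows "max_degree G ^ 2 / (sqrt (real (num_irr G)) * sqrt (real (Coset.order G)))
           \<le> real (max_kronecker_mult G) \<and>
         real (max_kronecker_mult G) \<le> max_degree G"
proof
  interpret finite_group G
    by (rule finite_group.intro[OF assms(1) finite_group_axioms.intro[OF assms(2)]])
  let ?s = "sqrt (real (num_irr G)) * sqrt (real (Coset.order G))"
  \<comment> \<open>Positivity makes the denominator nonzero, so the quotient is not the default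
    value of division by zero.\<close>
  have "num_irr G > 0"
    using finite_Irr trivial_character_in_Irr by (auto simp: num_irr_def card_gt_0_iff)
  then have s: "?s > 0" using order_pos by simp
  \<comment> \<open>The square roots are removed by comparing squares, which is legitimate because
    the right side is nonnegative.\<close>
  have "(max_degree G ^ 2)\<^sup>2 = max_degree G ^ 4"
    by (simp add: power4_eq_xxxx power2_eq_square)
  moreover have "(?s * real (max_kronecker_mult G))\<^sup>2 =
      real (num_irr G) * real (Coset.order G) * (real (max_kronecker_mult G))\<^sup>2"
    by (simp add: power_mult_distrib)
  ultimately have "(max_degree G ^ 2)\<^sup>2 \<le> (?s * real (max_kronecker_mult G))\<^sup>2"
    using max_degree_pow4_le by (simp only:)
  then have "max_degree G ^ 2 \<le> ?s * real (max_kronecker_mult G)"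
    by (rule power2_le_imp_le) simp
  then show "max_degree G ^ 2 / ?s \<le> real (max_kronecker_mult G)"
    by (subst pos_divide_le_eq[OF s], subst mult.commute)
  obtain \<rho> \<phi> \<psi> where mem: "\<rho> \<in> Irr G" "\<phi> \<in> Irr G" "\<psi> \<in> Irr G"
    and K: "kronecker_mult G \<rho> \<phi> \<psi> = max_kronecker_mult G"
    using max_kronecker_mult_attained .
  show "real (max_kronecker_mult G) \<le> max_degree G"
    unfolding K[symmetric]
    by (rule order_trans[OF kronecker_mult_le_degree[OF mem] degree_le_max_degree[OF mem(2)]])
qed

end
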